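(* Let $p\equiv 1\pmod 4$ be a prime and $g$ any primitive root of $p$. Then $$\prod_{\substack{r,s=1\\ r\ne s}}^{(p-1)/4}(g^{4r}-g^{4s})\equiv -\left(\frac{2}{p}\right)\pmod p,$$ where $\left(\frac{2}{p}\right)$ is the Legendre symbol. *)

theory Defs
  imports "HOL-Number_Theory.Number_Theory"
begin

end

theory Submission
  imports Defs "HOL-Computational_Algebra.Polynomial"
begin

text \<open>
  Put \<open>n = (p - 1) div 4\<close>. The elements \<open>g ^ (4 * r)\<close> are the \<open>n\<close> distinct roots of \<open>X ^ n - 1\<close>
  modulo \<open>p\<close>, so the inner product over \<open>s\<close> is the derivative of that polynomial at
  \<open>c = g ^ (4 * r)\<close>, namely \<open>n * c ^ (n - 1)\<close>. Hence the full product is \<open>n ^ n\<close> times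
  \<open>g ^ (2 * n * (n + 1) * (n - 1))\<close>, where \<open>g ^ (2 * n) = -1\<close>. Finally \<open>-4 * n = 1\<close> makes
  \<open>(-n) ^ n\<close> the inverse of \<open>4 ^ n = 2 ^ ((p - 1) div 2)\<close>, and Euler's criterion applies.
\<close>

text \<open>Lagrange's bound on roots modulo a prime, kept in integer polynomials: synthetic
  division by \<open>X - a\<close> leaves a remainder divisible by \<open>p\<close>, and since
  \<open>p\<close> does not divide \<open>b - a\<close> for the other \<open>b\<close> in
  \<open>A\<close>, the quotient inherits these as roots. The conclusion concerns values at every
  \<open>x\<close>, since these are what get compared later.\<close>

lemma poly_cong_0_if_many_roots:
  fixes f :: "int poly" and p :: int
  assumes "prime p" and "finite A"
    and "degree f < card A \<or> f = 0"
    and "\<And>a b. a \<in> A \<Longrightarrow> b \<in> A \<Longrightarrow> [a = b] (mod p) \<Longrightarrow> a = b"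
    and "\<And>a. a \<in> A \<Longrightarrow> p dvd poly f a"
  shows "p dvd poly f x"
  using assms(2-)
proof (induction A arbitrary: f x rule: finite_induct)
  case empty
  then show ?case by simp
next
  case (insert a A)
  define q where "q = synthetic_div f a"
  have f_eq: "poly f y = (y - a) * poly q y + poly f a" for y
  proof -
    have "poly f y = poly ([:-a, 1:] * q + [:poly f a:]) y"
      unfolding q_def by (subst synthetic_div_correct') simp
    then show ?thesis by (simp add: algebra_simps)
  qed
  have pa: "p dvd poly f a" using insert.prems(3) by simp
  show ?case
  \<comment> \<open>A constant must be treated apart: its quotient has degree 0 again, so the degree
    does not drop, but that quotient is the zero polynomial.\<close>
  proof (cases "degree f = 0")
    case True
    then have "q = 0" by (simp add: q_def synthetic_div_eq_0_iff)
    then show ?thesis using f_eq[of x] pa by simp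
  next
    case False
    have "p dvd poly q x"
    proof (rule insert.IH)
      show "degree q < card A \<or> q = 0"
        using insert.prems(1) insert.hyps False by (auto simp: q_def degree_synthetic_div)
      show "c = b" if "c \<in> A" "b \<in> A" "[c = b] (mod p)" for c b
        using insert.prems(2) that by blast
      show "p dvd poly q b" if b: "b \<in> A" for b
      proof -
        have "\<not> p dvd b - a"
          using insert.prems(2)[of b a] b insert.hyps(2) by (auto simp: cong_iff_dvd_diff)
        moreover have "p dvd (b - a) * poly q b"
          using f_eq[of b] pa insert.prems(3)[of b] b by (metis dvd_add_left_iff insertI2)
        ultimately show ?thesis
          using \<open>prime p\<close> prime_dvd_mult_iff by blast
      qed
    qed
    then show ?thesis using f_eq[of x] pa by simp
  qed
qed

text \<open>The leading terms cancel. The second disjunct is needed for \<open>d = 0\<close>, where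
  no degree lies below \<open>d\<close>.\<close>

lemma degree_diff_monic_less:
  fixes f h :: "int poly"
  assumes "degree f = d" "degree h = d" "lead_coeff f = 1" "lead_coeff h = 1"
  shows "degree (f - h) < d \<or> f - h = 0"
  using assms
  by (metis coeff_diff degree_diff_le diff_self le_refl leading_coeff_0_iff order_le_less)

text \<open>No derivative is taken. The cofactor \<open>S\<close> of \<open>X - c\<close> in
  \<open>X ^ n - c ^ n\<close> and the product \<open>P\<close> of the other linear factors are both
  monic of degree \<open>n - 1\<close>, and modulo \<open>p\<close> both vanish on
  \<open>A - {c}\<close>. Their difference has too small a degree for so many roots, so they also
  agree at \<open>c\<close>, where all \<open>n\<close> terms of \<open>S\<close> equal
  \<open>c ^ (n - 1)\<close>.\<close>

lemma prod_diff_roots_of_unity_cong: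
  fixes A :: "int set" and p c :: int
  assumes "prime p" and "finite A" and c: "c \<in> A"
    and inj: "\<And>a b. a \<in> A \<Longrightarrow> b \<in> A \<Longrightarrow> [a = b] (mod p) \<Longrightarrow> a = b"
    and root: "\<And>a. a \<in> A \<Longrightarrow> [a ^ card A = 1] (mod p)"
  shows "[(\<Prod>a\<in>A - {c}. c - a) = int (card A) * c ^ (card A - 1)] (mod p)"
proof -
  define n where "n = card A"
  have n: "n > 0" unfolding n_def using assms by (auto simp: card_gt_0_iff)
  have card: "card (A - {c}) = n - 1"
    using assms by (simp add: n_def)
  define S where "S = (\<Sum>k<n. monom (c ^ (n - Suc k)) k)"
  define P where "P = (\<Prod>a\<in>A - {c}. [:-a, 1:])"
  have coeffS: "coeff S i = (if i < n then c ^ (n - Suc i) else 0)" for i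
    by (simp add: S_def coeff_sum)
  have "degree S \<le> n - 1"
    by (rule degree_le) (use n in \<open>auto simp: coeffS\<close>)
  moreover have "n - 1 \<le> degree S"
    by (rule le_degree) (use n in \<open>auto simp: coeffS\<close>)
  ultimately have degS: "degree S = n - 1" by simp
  have lcS: "lead_coeff S = 1" using n by (simp add: degS coeffS)
  have degP: "degree P = n - 1"
    unfolding P_def by (subst degree_prod_eq_sum_degree) (auto simp: card)
  have lcP: "lead_coeff P = 1"
    unfolding P_def by (subst lead_coeff_prod) auto
  have polyS: "poly S x = (\<Sum>k<n. c ^ (n - Suc k) * x ^ k)" for x
    by (simp add: S_def poly_sum poly_monom)
  have polyP: "poly P x = (\<Prod>a\<in>A - {c}. x - a)" for x
    by (simp add: P_def poly_prod)
  have "p dvd poly (S - P) c"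
  proof (rule poly_cong_0_if_many_roots[where A = "A - {c}"])
    show "degree (S - P) < card (A - {c}) \<or> S - P = 0"
      unfolding card using degree_diff_monic_less degS degP lcS lcP by blast
    show "p dvd poly (S - P) a" if a: "a \<in> A - {c}" for a
    proof -
      have "poly P a = 0" unfolding polyP using a assms(2) by auto
      moreover have "p dvd poly S a"
      proof -
        have "a ^ n - c ^ n = (a - c) * poly S a"
          by (simp add: polyS power_diff_sumr2)
        moreover have "[a ^ n = c ^ n] (mod p)"
          using root[of a] root[of c] a c unfolding n_def by (metis DiffD1 cong_sym cong_trans)
        ultimately have "p dvd (a - c) * poly S a" by (simp add: cong_iff_dvd_diff)
        moreover have "\<not> p dvd a - c"
          using inj[of a c] a c by (auto simp: cong_iff_dvd_diff)
        ultimately show ?thesis using \<open>prime p\<close> prime_dvd_mult_iff by blast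
      qed
      ultimately show ?thesis by simp
    qed
  qed (use assms in auto)
  moreover have "poly S c = int n * c ^ (n - 1)"
  proof -
    have "poly S c = (\<Sum>k<n. c ^ (n - 1))"
      unfolding polyS by (intro sum.cong) (auto simp flip: power_add)
    then show ?thesis by simp
  qed
  ultimately have "[int n * c ^ (n - 1) = (\<Prod>a\<in>A - {c}. c - a)] (mod p)"
    by (simp add: cong_iff_dvd_diff polyP)
  then show ?thesis by (simp add: n_def cong_sym)
qed

text \<open>The order of an element lives on the naturals, so \<open>g\<close> is replaced by its
  residue \<open>h\<close>, whose order is the totient of \<open>p\<close>.\<close>

lemma residue_primroot_int_power_cong_iff:
  fixes p :: nat and g :: int
  assumes "prime p" and "residue_primroot p (nat (g mod int p))"
  shows "[g ^ i = g ^ j] (mod int p) \<longleftrightarrow> [i = j] (mod (p - 1))"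
proof -
  define h where "h = nat (g mod int p)"
  have p: "p > 0" using assms(1) prime_gt_0_nat by blast
  then have h: "int h = g mod int p" by (simp add: h_def)
  have pow: "[g ^ k = int (h ^ k)] (mod int p)" for k
    by (simp add: h cong_pow cong_sym)
  have "[g ^ i = g ^ j] (mod int p) \<longleftrightarrow> [int (h ^ i) = int (h ^ j)] (mod int p)"
    using pow[of i] pow[of j] by (meson cong_sym cong_trans)
  also have "\<dots> \<longleftrightarrow> [h ^ i = h ^ j] (mod p)"
    by (rule cong_int_iff)
  also have "\<dots> \<longleftrightarrow> [i = j] (mod ord p h)"
    using assms(2) by (intro order_divides_expdiff) (simp add: residue_primroot_def h_def)
  also have "ord p h = p - 1"
    using assms by (simp add: residue_primroot_def h_def totient_prime)
  finally show ?thesis .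
qed

theorem theorem2p10:
  fixes p :: nat and g :: int
  assumes "prime p" and "[p = 1] (mod 4)"
    and "residue_primroot p (nat (g mod int p))"
  shows "[(\<Prod>(r, s) \<in> {(r, s). r \<in> {1..(p - 1) div 4} \<and> s \<in> {1..(p - 1) div 4} \<and> r \<noteq> s}.
            (g ^ (4 * r) - g ^ (4 * s))) = - Legendre 2 (int p)] (mod int p)"
proof -
  define n where "n = (p - 1) div 4"
  have "p > 1" using assms(1) prime_gt_1_nat by blast
  moreover have "4 dvd p - 1"
    using assms(2) \<open>p > 1\<close> by (metis cong_to_1_nat)
  ultimately have p_eq: "p = 4 * n + 1" and n: "n > 0"
    unfolding n_def by auto
  have prime_p: "prime (int p)" using assms(1) by simp
  have pow_iff: "[g ^ i = g ^ j] (mod int p) \<longleftrightarrow> [i = j] (mod (4 * n))" for i j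
    using residue_primroot_int_power_cong_iff[OF assms(1,3)] by (simp add: p_eq)
  define f where "f r = g ^ (4 * r)" for r
  have f_inj: "r = s" if "r \<in> {1..n}" "s \<in> {1..n}" "[f r = f s] (mod int p)" for r s
  proof -
    have "[4 * r = 4 * s] (mod (4 * n))" using that by (simp add: f_def pow_iff)
    then have "[r = s] (mod n)" by (simp add: cong_def mult_mod_right[symmetric])
    \<comment> \<open>On \<open>{1..n}\<close> the only index not already reduced modulo
      \<open>n\<close> is \<open>n\<close> itself, which represents 0; hence the case split.\<close>
    then show ?thesis
      using that n by (cases "r = n"; cases "s = n") (auto simp: cong_def)
  qed
  then have inj: "inj_on f {1..n}" by (auto intro!: inj_onI)
  have inner: "[(\<Prod>s\<in>{1..n} - {r}. f r - f s) = int n * f r ^ (n - 1)] (mod int p)"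
    if r: "r \<in> {1..n}" for r
  proof -
    have "[(\<Prod>a\<in>f ` {1..n} - {f r}. f r - a)
            = int (card (f ` {1..n})) * f r ^ (card (f ` {1..n}) - 1)] (mod int p)"
    proof (rule prod_diff_roots_of_unity_cong[OF prime_p])
      show "[a ^ card (f ` {1..n}) = 1] (mod int p)" if "a \<in> f ` {1..n}" for a
      proof -
        obtain s where "a = f s" using \<open>a \<in> f ` {1..n}\<close> by blast
        moreover have "[g ^ (4 * s * n) = g ^ 0] (mod int p)"
          unfolding pow_iff by (simp add: cong_def mult.commute mult.left_commute)
        ultimately have "[a ^ n = 1] (mod int p)" by (simp add: f_def power_mult)
        then show ?thesis using inj by (simp add: card_image)
      qed
      show "a = b" if "a \<in> f ` {1..n}" "b \<in> f ` {1..n}" "[a = b] (mod int p)" for a b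
        using that f_inj by blast
    qed (use r in auto)
    moreover have "f ` {1..n} - {f r} = f ` ({1..n} - {r})"
      using inj_on_image_set_diff[OF inj, of "{1..n}" "{r}"] r by auto
    moreover have "(\<Prod>a\<in>f ` ({1..n} - {r}). f r - a) = (\<Prod>s\<in>{1..n} - {r}. f r - f s)"
      using inj_on_subset[OF inj, of "{1..n} - {r}"] by (simp add: prod.reindex)
    ultimately show ?thesis using inj by (simp add: card_image)
  qed
  have half: "[g ^ (2 * n) = -1] (mod int p)"
  proof -
    have "[g ^ (4 * n) = g ^ 0] (mod int p)" unfolding pow_iff by (simp add: cong_def)
    moreover have "g ^ (4 * n) - 1 = (g ^ (2 * n) - 1) * (g ^ (2 * n) + 1)"
      by (simp add: algebra_simps flip: power_add)
    ultimately have "int p dvd (g ^ (2 * n) - 1) * (g ^ (2 * n) + 1)"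
      by (simp add: cong_iff_dvd_diff)
    \<comment> \<open>The power is a square root of 1; since \<open>2 * n\<close> is not a multiple
      of the order \<open>4 * n\<close>, it is not 1 and must be -1.\<close>
    moreover have "\<not> [g ^ (2 * n) = g ^ 0] (mod int p)"
      unfolding pow_iff using n by (simp add: cong_def)
    ultimately show ?thesis
      using prime_p by (auto simp: cong_iff_dvd_diff prime_dvd_mult_iff)
  qed
  have "(\<Prod>(r, s) \<in> {(r, s). r \<in> {1..n} \<and> s \<in> {1..n} \<and> r \<noteq> s}. (g ^ (4 * r) - g ^ (4 * s)))
      = (\<Prod>r\<in>{1..n}. \<Prod>s\<in>{1..n} - {r}. f r - f s)"
  proof -
    have "{(r, s). r \<in> {1..n} \<and> s \<in> {1..n} \<and> r \<noteq> s} = (SIGMA r:{1..n}. {1..n} - {r})"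
      by auto
    then show ?thesis by (simp add: prod.Sigma f_def)
  qed
  also have "[\<dots> = (\<Prod>r\<in>{1..n}. int n * f r ^ (n - 1))] (mod int p)"
    using inner by (intro cong_prod) auto
  also have "(\<Prod>r\<in>{1..n}. int n * f r ^ (n - 1)) = int n ^ n * g ^ (4 * (\<Sum>r=1..n. r) * (n - 1))"
  proof -
    have "(\<Prod>r\<in>{1..n}. int n * f r ^ (n - 1)) = int n ^ n * (\<Prod>r\<in>{1..n}. g ^ (4 * r * (n - 1)))"
      by (simp add: f_def prod.distrib power_mult)
    also have "\<dots> = int n ^ n * g ^ (\<Sum>r=1..n. 4 * r * (n - 1))"
      by (simp only: power_sum)
    finally show ?thesis by (simp only: sum_distrib_left sum_distrib_right)
  qed
  \<comment> \<open>The triangular sum makes \<open>2 * n\<close> a factor of the exponent, so that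
    \<open>half\<close> turns the power of \<open>g\<close> into a sign.\<close>
  also have "4 * (\<Sum>r=1..n. r) * (n - 1) = 2 * n * ((n + 1) * (n - 1))"
  proof -
    have "2 * (\<Sum>r=1..n. r) = n * (n + 1)"
      by (induction n) auto
    then have "4 * (\<Sum>r=1..n. r) = 2 * n * (n + 1)" by simp
    then show ?thesis by (simp only: mult.assoc)
  qed
  also have "[int n ^ n * g ^ (2 * n * ((n + 1) * (n - 1)))
      = int n ^ n * (-1) ^ ((n + 1) * (n - 1))] (mod int p)"
    unfolding power_mult[of g "2 * n"] by (intro cong_mult cong_pow half cong_refl)
  \<comment> \<open>For even \<open>n\<close> the exponent of -1 is odd; for odd \<open>n\<close> it
    is even, and the two minus signs on the right cancel. Positivity of \<open>n\<close> keeps the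
    subtraction \<open>n - 1\<close> from truncating.\<close>
  also have "int n ^ n * (-1) ^ ((n + 1) * (n - 1)) = - ((- int n) ^ n)"
    using n by (cases "even n") (auto simp: minus_one_power_iff)
  also have "[- ((- int n) ^ n) = - Legendre 2 (int p)] (mod int p)"
  proof -
    define L where "L = Legendre 2 (int p)"
    have "p > 2" using p_eq n by simp
    then have L: "[L = 2 ^ (2 * n)] (mod int p)"
      using euler_criterion[OF assms(1), of 2] by (simp add: L_def p_eq)
    \<comment> \<open>As 2 is nonzero modulo \<open>p\<close>, \<open>L\<close> is 1 or -1 and hence
      its own inverse; multiplying by \<open>L\<close> at the end therefore turns an inverse of
      \<open>L\<close> into \<open>L\<close> itself.\<close>
    have "\<not> [2 = 0] (mod int p)"
      using \<open>p > 2\<close> by (simp add: cong_def)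
    then have LL: "L * L = 1" by (simp add: L_def Legendre_def)
    have "[- int n * 4 = 1] (mod int p)"
      unfolding cong_iff_dvd_diff by (rule dvdI[of _ _ "-1"]) (simp add: p_eq)
    then have "[(- int n * 4) ^ n = 1 ^ n] (mod int p)" by (rule cong_pow)
    then have "[(- int n) ^ n * 4 ^ n = 1] (mod int p)" by (simp only: power_mult_distrib power_one)
    moreover have "[(- int n) ^ n * L = (- int n) ^ n * 4 ^ n] (mod int p)"
      using L by (intro cong_mult cong_refl) (simp add: power_mult)
    ultimately have "[(- int n) ^ n * L = 1] (mod int p)" by (rule cong_trans[rotated])
    then have "[(- int n) ^ n * L * L = 1 * L] (mod int p)" by (rule cong_mult) simp
    then have "[(- int n) ^ n = L] (mod int p)" by (simp add: mult.assoc LL)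
    then show ?thesis by (simp add: L_def cong_minus_minus_iff)
  qed
  finally show ?thesis by (simp add: n_def)
qed

end
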